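(* Let $R$ be a commutative ring with unity and let $M$ be an $R$-module with $\operatorname{Spec}(M)\neq\emptyset$. Then every isolated point of $\widetilde{\operatorname{Spec}(M)}$ is a minimal prime submodule of $M$. In particular, if $M$ is a multiplication module, then every minimal prime submodule of $M$ is an isolated point of $\widetilde{\operatorname{Spec}(M)}$.
   Context: For a submodule $N$ of an $R$-module $M$, $(N:M)=\{r\in R : rM\subseteq N\}$. A proper submodule $P$ of $M$ is prime if whenever $rm\in P$ with $r\in R$, $m\in M$, then $m\in P$ or $r\in(P:M)$; in this case $(P:M)$ is a prime ideal of $R$. $\operatorname{Spec}(M)$ is the set of all prime submodules of $M$. A subset $T\subseteq R$ is multiplicatively closed if $1\in T$ and $xy\in T$ whenever $x,y\in T$. For a family $\mathcal{S}=\{S_i\}_{i\in I}$ of multiplicatively closed subsets of $R$, $\widetilde{V}(\mathcal{S})=\{P\in\operatorname{Spec}(M) \mid (P:M)\cap S_i\neq\emptyset \text{ for all } i\in I\}$. $\widetilde{\operatorname{Spec}(M)}$ denotes the set $\operatorname{Spec}(M)$ with the topology whose closed sets are exactly the sets $\widetilde{V}(\mathcal{S})$, $\mathcal{S}$ ranging over all families of multiplicatively closed subsets of $R$. A point $x$ of a topological space $X$ is isolated if $\{x\}$ is open in $X$. A minimal prime submodule of $M$ is a minimal element of $\operatorname{Spec}(M)$ with respect to inclusion. $M$ is a multiplication module if every submodule $N$ of $M$ has the form $N=IM$ for some ideal $I$ of $R$ (equivalently $N=(N:M)M$). *)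

theory Defs
  imports "HOL-Algebra.Module" "HOL-Algebra.Ideal" "HOL-Analysis.Abstract_Topology"
begin

text \<open>The ideal \<open>(N : M)\<close>.\<close>

definition module_residual ::
    "('a, 'c) ring_scheme \<Rightarrow> ('a, 'b, 'd) module_scheme \<Rightarrow> 'b set \<Rightarrow> 'a set"
  where "module_residual R M N = {r \<in> carrier R. \<forall>m \<in> carrier M. r \<odot>\<^bsub>M\<^esub> m \<in> N}"

definition prime_submodule ::
    "('a, 'c) ring_scheme \<Rightarrow> ('a, 'b, 'd) module_scheme \<Rightarrow> 'b set \<Rightarrow> bool"
  where "prime_submodule R M P \<longleftrightarrow>
    submodule P R M \<and> P \<noteq> carrier M \<and>
    (\<forall>r \<in> carrier R. \<forall>m \<in> carrier M.
       r \<odot>\<^bsub>M\<^esub> m \<in> P \<longrightarrow> m \<in> P \<or> r \<in> module_residual R M P)"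

definition module_Spec ::
    "('a, 'c) ring_scheme \<Rightarrow> ('a, 'b, 'd) module_scheme \<Rightarrow> 'b set set"
  where "module_Spec R M = {P. prime_submodule R M P}"

definition minimal_prime_submodule ::
    "('a, 'c) ring_scheme \<Rightarrow> ('a, 'b, 'd) module_scheme \<Rightarrow> 'b set \<Rightarrow> bool"
  where "minimal_prime_submodule R M P \<longleftrightarrow>
    P \<in> module_Spec R M \<and> (\<forall>Q \<in> module_Spec R M. Q \<subseteq> P \<longrightarrow> Q = P)"

text \<open>A multiplicatively closed set may contain zero.\<close>

definition mult_closed :: "('a, 'c) ring_scheme \<Rightarrow> 'a set \<Rightarrow> bool"
  where "mult_closed R T \<longleftrightarrow>
    T \<subseteq> carrier R \<and> \<one>\<^bsub>R\<^esub> \<in> T \<and> (\<forall>x \<in> T. \<forall>y \<in> T. x \<otimes>\<^bsub>R\<^esub> y \<in> T)"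

text \<open>Families of multiplicatively closed sets are represented by the set of their members
  (possibly empty), since neither order nor repetition matters for \<open>Vtilde\<close>.\<close>

definition Vtilde ::
    "('a, 'c) ring_scheme \<Rightarrow> ('a, 'b, 'd) module_scheme \<Rightarrow> 'a set set \<Rightarrow> 'b set set"
  where "Vtilde R M \<S> = {P \<in> module_Spec R M. \<forall>S \<in> \<S>. module_residual R M P \<inter> S \<noteq> {}}"

text \<open>That this is a topology on \<open>module_Spec R M\<close> whose closed sets are exactly the sets
  \<open>Vtilde R M \<S>\<close> is shown at the end of this theory.\<close>

definition Spec_tilde ::
    "('a, 'c) ring_scheme \<Rightarrow> ('a, 'b, 'd) module_scheme \<Rightarrow> 'b set topology"
  where "Spec_tilde R M =
    topology (\<lambda>U. \<exists>\<S>. (\<forall>S \<in> \<S>. mult_closed R S) \<and> U = module_Spec R M - Vtilde R M \<S>)"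

definition isolated_point :: "'x topology \<Rightarrow> 'x \<Rightarrow> bool"
  where "isolated_point X x \<longleftrightarrow> x \<in> topspace X \<and> openin X {x}"

text \<open>The submodule \<open>IM\<close> of finite sums of products \<open>i m\<close>, for an ideal \<open>I\<close>.\<close>

inductive_set ideal_smult ::
    "'a set \<Rightarrow> ('a, 'b, 'd) module_scheme \<Rightarrow> 'b set"
  for I and M where
    smult: "\<lbrakk>i \<in> I; m \<in> carrier M\<rbrakk> \<Longrightarrow> i \<odot>\<^bsub>M\<^esub> m \<in> ideal_smult I M"
  | sum: "\<lbrakk>x \<in> ideal_smult I M; y \<in> ideal_smult I M\<rbrakk> \<Longrightarrow> x \<oplus>\<^bsub>M\<^esub> y \<in> ideal_smult I M"

definition multiplication_module ::
    "('a, 'c) ring_scheme \<Rightarrow> ('a, 'b, 'd) module_scheme \<Rightarrow> bool"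
  where "multiplication_module R M \<longleftrightarrow>
    (\<forall>N. submodule N R M \<longrightarrow> (\<exists>I. ideal I R \<and> N = ideal_smult I M))"

context Module.module
begin

lemma residual_prime:
  assumes P: "prime_submodule R M P" and x: "x \<in> carrier R" and y: "y \<in> carrier R"
    and xy: "x \<otimes>\<^bsub>R\<^esub> y \<in> module_residual R M P"
  shows "x \<in> module_residual R M P \<or> y \<in> module_residual R M P"
proof (rule ccontr)
  assume n: "\<not> ?thesis"
  then obtain m where m: "m \<in> carrier M" "y \<odot>\<^bsub>M\<^esub> m \<notin> P"
    using y by (auto simp: module_residual_def)
  have "x \<odot>\<^bsub>M\<^esub> (y \<odot>\<^bsub>M\<^esub> m) \<in> P"
    using xy m x y by (auto simp: module_residual_def smult_assoc1)
  moreover have "y \<odot>\<^bsub>M\<^esub> m \<in> carrier M" using m y by simp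
  ultimately show False using P n m x unfolding prime_submodule_def by blast
qed

lemma residual_one:
  assumes "prime_submodule R M P"
  shows "\<one>\<^bsub>R\<^esub> \<notin> module_residual R M P"
proof
  assume "\<one>\<^bsub>R\<^esub> \<in> module_residual R M P"
  then have "carrier M \<subseteq> P" by (auto simp: module_residual_def)
  moreover have "P \<subseteq> carrier M"
    using assms submoduleE(1) by (auto simp: prime_submodule_def)
  ultimately show False using assms by (auto simp: prime_submodule_def)
qed

lemma mult_closed_prod:
  assumes S: "mult_closed R S" and T: "mult_closed R T"
  shows "mult_closed R (S <#>\<^bsub>R\<^esub> T)"
  unfolding mult_closed_def
proof (intro conjI ballI)
  have carr: "S \<subseteq> carrier R" "T \<subseteq> carrier R" using S T by (auto simp: mult_closed_def)
  then show "S <#>\<^bsub>R\<^esub> T \<subseteq> carrier R" by (auto simp: set_mult_def)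
  have "\<one>\<^bsub>R\<^esub> \<in> S" "\<one>\<^bsub>R\<^esub> \<in> T" using S T by (auto simp: mult_closed_def)
  then show "\<one>\<^bsub>R\<^esub> \<in> S <#>\<^bsub>R\<^esub> T" by (force simp: set_mult_def)
  fix u v assume "u \<in> S <#>\<^bsub>R\<^esub> T" "v \<in> S <#>\<^bsub>R\<^esub> T"
  then obtain x y x' y' where xy: "x \<in> S" "y \<in> T" "x' \<in> S" "y' \<in> T"
    and u: "u = x \<otimes>\<^bsub>R\<^esub> y" and v: "v = x' \<otimes>\<^bsub>R\<^esub> y'"
    by (auto simp: set_mult_def)
  have "x \<in> carrier R" "y \<in> carrier R" "x' \<in> carrier R" "y' \<in> carrier R"
    using xy carr by auto
  then have "u \<otimes>\<^bsub>R\<^esub> v = (x \<otimes>\<^bsub>R\<^esub> x') \<otimes>\<^bsub>R\<^esub> (y \<otimes>\<^bsub>R\<^esub> y')"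
    unfolding u v by (simp add: R.m_ac)
  moreover have "x \<otimes>\<^bsub>R\<^esub> x' \<in> S" "y \<otimes>\<^bsub>R\<^esub> y' \<in> T"
    using xy S T by (auto simp: mult_closed_def)
  ultimately show "u \<otimes>\<^bsub>R\<^esub> v \<in> S <#>\<^bsub>R\<^esub> T" unfolding set_mult_def by blast
qed

lemma residual_meets_prod:
  assumes P: "prime_submodule R M P" and S: "mult_closed R S" and T: "mult_closed R T"
  shows "module_residual R M P \<inter> (S <#>\<^bsub>R\<^esub> T) \<noteq> {} \<longleftrightarrow>
    module_residual R M P \<inter> S \<noteq> {} \<or> module_residual R M P \<inter> T \<noteq> {}"
    (is "?l \<longleftrightarrow> ?r")
proof
  have carr: "S \<subseteq> carrier R" "T \<subseteq> carrier R" using S T by (auto simp: mult_closed_def)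
  have one: "\<one>\<^bsub>R\<^esub> \<in> S" "\<one>\<^bsub>R\<^esub> \<in> T" using S T by (auto simp: mult_closed_def)
  {
    assume ?l
    then obtain x y where "x \<in> S" "y \<in> T" "x \<otimes>\<^bsub>R\<^esub> y \<in> module_residual R M P"
      by (auto simp: set_mult_def)
    then show ?r using residual_prime[OF P, of x y] carr by blast
  next
    assume ?r
    then consider x where "x \<in> module_residual R M P" "x \<in> S"
      | y where "y \<in> module_residual R M P" "y \<in> T"
      by blast
    then show ?l
    proof cases
      case 1
      then have "x \<otimes>\<^bsub>R\<^esub> \<one>\<^bsub>R\<^esub> = x" using carr by (simp add: subsetD)
      then have "x \<in> S <#>\<^bsub>R\<^esub> T" using 1 one by (force simp: set_mult_def)
      then show ?thesis using 1 by blast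
    next
      case 2
      then have "\<one>\<^bsub>R\<^esub> \<otimes>\<^bsub>R\<^esub> y = y" using carr by (simp add: subsetD)
      then have "y \<in> S <#>\<^bsub>R\<^esub> T" using 2 one by (force simp: set_mult_def)
      then show ?thesis using 2 by blast
    qed
  }
qed

lemma Vtilde_Un:
  assumes A: "\<forall>S \<in> \<A>. mult_closed R S" and B: "\<forall>S \<in> \<B>. mult_closed R S"
  shows "Vtilde R M \<A> \<union> Vtilde R M \<B> =
    Vtilde R M ((\<lambda>(S, T). S <#>\<^bsub>R\<^esub> T) ` (\<A> \<times> \<B>))"
proof -
  have "P \<in> Vtilde R M ((\<lambda>(S, T). S <#>\<^bsub>R\<^esub> T) ` (\<A> \<times> \<B>)) \<longleftrightarrow>
      P \<in> Vtilde R M \<A> \<or> P \<in> Vtilde R M \<B>" for P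
  proof (cases "prime_submodule R M P")
    case True
    have "P \<in> Vtilde R M ((\<lambda>(S, T). S <#>\<^bsub>R\<^esub> T) ` (\<A> \<times> \<B>)) \<longleftrightarrow>
        (\<forall>S \<in> \<A>. \<forall>T \<in> \<B>. module_residual R M P \<inter> (S <#>\<^bsub>R\<^esub> T) \<noteq> {})"
      using True by (auto simp: Vtilde_def module_Spec_def)
    also have "\<dots> \<longleftrightarrow> (\<forall>S \<in> \<A>. \<forall>T \<in> \<B>.
        module_residual R M P \<inter> S \<noteq> {} \<or> module_residual R M P \<inter> T \<noteq> {})"
      using residual_meets_prod[OF True] A B by (intro ball_cong refl) blast
    also have "\<dots> \<longleftrightarrow> P \<in> Vtilde R M \<A> \<or> P \<in> Vtilde R M \<B>"
      using True unfolding Vtilde_def module_Spec_def by blast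
    finally show ?thesis .
  next
    case False
    then show ?thesis by (simp add: Vtilde_def module_Spec_def)
  qed
  then show ?thesis by blast
qed

lemma istopology_Spec_tilde:
  "istopology (\<lambda>U. \<exists>\<S>. (\<forall>S \<in> \<S>. mult_closed R S) \<and> U = module_Spec R M - Vtilde R M \<S>)"
    (is "istopology ?op")
  unfolding istopology_def
proof (intro conjI allI impI)
  fix U V assume "?op U" "?op V"
  then obtain \<A> \<B> where A: "\<forall>S \<in> \<A>. mult_closed R S" "U = module_Spec R M - Vtilde R M \<A>"
    and B: "\<forall>S \<in> \<B>. mult_closed R S" "V = module_Spec R M - Vtilde R M \<B>"
    by auto
  let ?C = "(\<lambda>(S, T). S <#>\<^bsub>R\<^esub> T) ` (\<A> \<times> \<B>)"
  have "\<forall>S \<in> ?C. mult_closed R S" using A(1) B(1) mult_closed_prod by auto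
  moreover have "U \<inter> V = module_Spec R M - Vtilde R M ?C"
    using Vtilde_Un[OF A(1) B(1)] A(2) B(2) by blast
  ultimately show "?op (U \<inter> V)" by blast
next
  fix \<K> assume K: "\<forall>K \<in> \<K>. ?op K"
  let ?D = "\<Union>{\<S>. (\<forall>S \<in> \<S>. mult_closed R S) \<and> module_Spec R M - Vtilde R M \<S> \<in> \<K>}"
  have "\<Union>\<K> = module_Spec R M - Vtilde R M ?D"
  proof (intro equalityI subsetI)
    fix P assume "P \<in> \<Union>\<K>"
    then obtain U where U: "U \<in> \<K>" "P \<in> U" by blast
    with K obtain \<S> where "\<forall>S \<in> \<S>. mult_closed R S" "U = module_Spec R M - Vtilde R M \<S>"
      by blast
    with U show "P \<in> module_Spec R M - Vtilde R M ?D" unfolding Vtilde_def by blast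
  next
    fix P assume "P \<in> module_Spec R M - Vtilde R M ?D"
    then obtain \<S> S where "S \<in> \<S>" "module_Spec R M - Vtilde R M \<S> \<in> \<K>"
      "module_residual R M P \<inter> S = {}" "P \<in> module_Spec R M"
      unfolding Vtilde_def by blast
    then have "P \<in> module_Spec R M - Vtilde R M \<S>" unfolding Vtilde_def by blast
    then show "P \<in> \<Union>\<K>" using \<open>module_Spec R M - Vtilde R M \<S> \<in> \<K>\<close> by blast
  qed
  moreover have "\<forall>S \<in> ?D. mult_closed R S" by blast
  ultimately show "?op (\<Union>\<K>)" by blast
qed

lemma openin_Spec_tilde:
  "openin (Spec_tilde R M) U \<longleftrightarrow>
    (\<exists>\<S>. (\<forall>S \<in> \<S>. mult_closed R S) \<and> U = module_Spec R M - Vtilde R M \<S>)"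
  by (simp add: Spec_tilde_def topology_inverse'[OF istopology_Spec_tilde])

lemma topspace_Spec_tilde: "topspace (Spec_tilde R M) = module_Spec R M"
proof
  show "topspace (Spec_tilde R M) \<subseteq> module_Spec R M"
    using iffD1[OF openin_Spec_tilde openin_topspace] by blast
  have "Vtilde R M {{\<one>\<^bsub>R\<^esub>}} = {}"
    using residual_one by (auto simp: Vtilde_def module_Spec_def)
  moreover have "\<forall>S \<in> {{\<one>\<^bsub>R\<^esub>}}. mult_closed R S" by (simp add: mult_closed_def)
  ultimately have "openin (Spec_tilde R M) (module_Spec R M)"
    unfolding openin_Spec_tilde by (metis Diff_empty)
  then show "module_Spec R M \<subseteq> topspace (Spec_tilde R M)" by (rule openin_subset)
qed

lemma closedin_Spec_tilde:
  "closedin (Spec_tilde R M) C \<longleftrightarrow> (\<exists>\<S>. (\<forall>S \<in> \<S>. mult_closed R S) \<and> C = Vtilde R M \<S>)"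
proof -
  have V: "Vtilde R M \<S> \<subseteq> module_Spec R M" for \<S> by (auto simp: Vtilde_def)
  then have "C \<subseteq> module_Spec R M \<and> module_Spec R M - C = module_Spec R M - Vtilde R M \<S>
      \<longleftrightarrow> C = Vtilde R M \<S>" for \<S>
    by blast
  then show ?thesis
    unfolding closedin_def topspace_Spec_tilde openin_Spec_tilde by metis
qed

end

end

theory Submission
  imports Defs
begin

text \<open>A basic open set \<open>{Q. (Q : M) \<inter> S = {}}\<close> contains with \<open>P\<close> every smaller prime submodule,
  so an open singleton consists of a minimal one. Conversely, for \<open>S = R - (P : M)\<close> this open
  set is \<open>{Q. (Q : M) \<subseteq> (P : M)}\<close>, and in a multiplication module this inclusion
  forces \<open>Q \<subseteq> P\<close>.\<close>

lemma module_residual_mono: "N \<subseteq> P \<Longrightarrow> module_residual R M N \<subseteq> module_residual R M P"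
  by (auto simp: module_residual_def)

context Module.module
begin

lemma minimal_if_isolated:
  assumes "isolated_point (Spec_tilde R M) P"
  shows "minimal_prime_submodule R M P"
proof -
  obtain \<S> where S: "{P} = module_Spec R M - Vtilde R M \<S>"
    using assms unfolding isolated_point_def openin_Spec_tilde by blast
  then have P: "P \<in> module_Spec R M" by blast
  \<comment> \<open>As \<open>P\<close> lies outside the closed set, one member of the family
    already misses \<open>(P : M)\<close>. The same member misses the smaller ideal
    \<open>(Q : M)\<close> for each prime \<open>Q\<close> inside \<open>P\<close>, so
    \<open>Q\<close> lies in the open set too.\<close>
  from S P obtain S where S': "S \<in> \<S>" "module_residual R M P \<inter> S = {}"
    unfolding Vtilde_def by blast
  have "Q = P" if Q: "Q \<in> module_Spec R M" "Q \<subseteq> P" for Q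
  proof -
    have "module_residual R M Q \<inter> S = {}"
      using S' module_residual_mono[OF Q(2), of R M] by blast
    then have "Q \<in> module_Spec R M - Vtilde R M \<S>"
      using Q(1) S'(1) unfolding Vtilde_def by blast
    then show ?thesis using S by blast
  qed
  with P show ?thesis unfolding minimal_prime_submodule_def by blast
qed

text \<open>Closure under products is primeness of the ideal \<open>(P : M)\<close>; it omits
  \<open>\<one>\<close> because \<open>P\<close> is proper.\<close>

lemma mult_closed_residual_compl:
  assumes "prime_submodule R M P"
  shows "mult_closed R (carrier R - module_residual R M P)"
  unfolding mult_closed_def
proof (intro conjI ballI)
  fix x y
  assume "x \<in> carrier R - module_residual R M P" "y \<in> carrier R - module_residual R M P"
  then show "x \<otimes>\<^bsub>R\<^esub> y \<in> carrier R - module_residual R M P"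
    using residual_prime[OF assms, of x y] by blast
qed (use residual_one[OF assms] in simp_all)

text \<open>A Galois connection between \<open>I \<mapsto> IM\<close> and
  \<open>N \<mapsto> (N : M)\<close>: a submodule is closed under sums, so only the generators
  \<open>i m\<close> of \<open>IM\<close> matter.\<close>

lemma ideal_smult_subset_iff:
  assumes "submodule N R M" and "I \<subseteq> carrier R"
  shows "ideal_smult I M \<subseteq> N \<longleftrightarrow> I \<subseteq> module_residual R M N"
proof
  assume "ideal_smult I M \<subseteq> N"
  then show "I \<subseteq> module_residual R M N"
    using assms(2) by (auto simp: module_residual_def intro: ideal_smult.smult)
next
  assume I: "I \<subseteq> module_residual R M N"
  have "x \<in> N" if "x \<in> ideal_smult I M" for x
    using that
  proof induction
    case (smult i m)
    then show ?case using I by (auto simp: module_residual_def)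
  next
    case (sum x y)
    then show ?case using submoduleE(5)[OF assms(1)] by blast
  qed
  then show "ideal_smult I M \<subseteq> N" by blast
qed

text \<open>Write \<open>N = IM\<close>. Then \<open>I\<close> lies in \<open>(N : M)\<close>, hence
  in \<open>(P : M)\<close>, and the Galois connection turns this back into
  \<open>IM \<subseteq> P\<close>.\<close>

lemma multiplication_module_residual_le_iff:
  assumes "multiplication_module R M" and N: "submodule N R M" and P: "submodule P R M"
  shows "module_residual R M N \<subseteq> module_residual R M P \<longleftrightarrow> N \<subseteq> P"
proof
  assume le: "module_residual R M N \<subseteq> module_residual R M P"
  obtain I where I: "ideal I R" "N = ideal_smult I M"
    using assms(1) N unfolding multiplication_module_def by blast
  from I(1) have "I \<subseteq> carrier R"
    by (simp add: additive_subgroup.a_subset ideal.axioms(1))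
  then show "N \<subseteq> P"
    using ideal_smult_subset_iff[OF N, of I] ideal_smult_subset_iff[OF P, of I] I(2) le
    by simp
qed (rule module_residual_mono)

lemma isolated_if_minimal:
  assumes mult: "multiplication_module R M" and P: "minimal_prime_submodule R M P"
  shows "isolated_point (Spec_tilde R M) P"
proof -
  let ?S = "carrier R - module_residual R M P"
  from P have Spec: "P \<in> module_Spec R M"
    and min: "\<And>Q. Q \<in> module_Spec R M \<Longrightarrow> Q \<subseteq> P \<Longrightarrow> Q = P"
    unfolding minimal_prime_submodule_def by blast+
  \<comment> \<open>Residuals consist of ring elements, so missing the complement of
    \<open>(P : M)\<close> means lying inside \<open>(P : M)\<close>.\<close>
  have "module_Spec R M - Vtilde R M {?S} =
      {Q \<in> module_Spec R M. module_residual R M Q \<subseteq> module_residual R M P}"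
    by (auto simp: Vtilde_def module_residual_def)
  also have "\<dots> = {Q \<in> module_Spec R M. Q \<subseteq> P}"
    using multiplication_module_residual_le_iff[OF mult] Spec
    unfolding module_Spec_def prime_submodule_def by blast
  \<comment> \<open>Minimality of \<open>P\<close> leaves no other prime submodule below it.\<close>
  also have "\<dots> = {P}" using min Spec by blast
  finally have "{P} = module_Spec R M - Vtilde R M {?S}" ..
  moreover have "\<forall>S \<in> {?S}. mult_closed R S"
    using mult_closed_residual_compl Spec by (simp add: module_Spec_def)
  ultimately have "openin (Spec_tilde R M) {P}"
    unfolding openin_Spec_tilde by blast
  with Spec show ?thesis by (simp add: isolated_point_def topspace_Spec_tilde)
qed

end

theorem lemma2:
  fixes R :: "('a, 'c) ring_scheme" and M :: "('a, 'b, 'd) module_scheme"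
  assumes "Module.module R M"
    and "module_Spec R M \<noteq> {}"
  shows "(\<forall>P. isolated_point (Spec_tilde R M) P \<longrightarrow> minimal_prime_submodule R M P) \<and>
    (multiplication_module R M \<longrightarrow>
      (\<forall>P. minimal_prime_submodule R M P \<longrightarrow> isolated_point (Spec_tilde R M) P))"
  using module.minimal_if_isolated[OF assms(1)] module.isolated_if_minimal[OF assms(1)] by blast

end
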